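(* Let $I = [0,1]$, let $\mathbb{P}$ be the set of irrationals in $I$, and let $\mathbb{P} \times I$ carry the product topology. Let $CL(\mathbb{P} \times I)$ be the collection of all nonempty closed subsets of $\mathbb{P} \times I$, equipped with the Wijsman topology $\tau_W$ determined by a metric $d$ generating the topology of $\mathbb{P} \times I$. Then the set $F_0(\mathbb{P} \times I) = \{A : A \text{ is a closed subset of } \mathbb{P} \times I \text{ with } \dim A = 0\}$ is not a Borel set, and is not even a Souslin set, in $CL(\mathbb{P} \times I)$.
   Context: For a separable completely metrizable space $E$ with a metric $d$ generating its topology, the Wijsman topology $\tau_W$ on the collection $CL(E)$ of nonempty closed subsets of $E$ is the weakest topology making all functionals $A \mapsto \mathrm{dist}(z,A) = \inf_{a \in A} d(z,a)$, $z \in E$, continuous. A subset of $CL(E)$ is Souslin if it is the result of the Souslin operation on Borel sets of $(CL(E), \tau_W)$, i.e. of the form $\bigcup_{\sigma \in \mathbb{N}^{\mathbb{N}}} \bigcap_{n} \mathscr{A}_{\sigma|n}$ with all $\mathscr{A}_{\sigma|n}$ Borel, where $\sigma|n$ is the restriction of $\sigma$ to its first $n$ terms. Here $\dim$ is the usual topological dimension for separable metrizable spaces (covering dimension, which coincides with small and large inductive dimension), with $\dim \emptyset = -1$. *)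

theory Defs
  imports "HOL-Analysis.Analysis"
begin

section \<open>The Wijsman hyperspace\<close>

definition CL :: "'a topology \<Rightarrow> 'a set set"
  where "CL X = {A. closedin X A \<and> A \<noteq> {}}"

definition dist_to :: "('a \<Rightarrow> 'a \<Rightarrow> real) \<Rightarrow> 'a \<Rightarrow> 'a set \<Rightarrow> real"
  where "dist_to d z A = (INF a\<in>A. d z a)"

definition wijsman_topology :: "'a topology \<Rightarrow> ('a \<Rightarrow> 'a \<Rightarrow> real) \<Rightarrow> 'a set topology"
  where "wijsman_topology X d =
    topology_generated_by {{A \<in> CL X. dist_to d z A \<in> U} |z U. z \<in> topspace X \<and> open U}"

lemma topspace_wijsman_topology [simp]: "topspace (wijsman_topology X d) = CL X"
proof -
  have "A \<in> topspace (wijsman_topology X d)" if A: "A \<in> CL X" for A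
  proof -
    obtain z where "z \<in> topspace X"
      using A closedin_subset unfolding CL_def by fastforce
    then have "{B \<in> CL X. dist_to d z B \<in> UNIV}
        \<in> {{A \<in> CL X. dist_to d z A \<in> U} |z U. z \<in> topspace X \<and> open U}"
      using open_UNIV by blast
    then show ?thesis
      using A unfolding wijsman_topology_def topology_generated_by_topspace by blast
  qed
  then show ?thesis
    by (auto simp: wijsman_topology_def)
qed

lemma continuous_map_dist_to:
  assumes "z \<in> topspace X"
  shows "continuous_map (wijsman_topology X d) euclideanreal (dist_to d z)"
  unfolding continuous_map_def topspace_wijsman_topology
  using assms by (auto simp: wijsman_topology_def intro!: topology_generated_by_Basis)

lemma wijsman_topology_weakest:
  assumes "topspace T = CL X"
    and "\<And>z. z \<in> topspace X \<Longrightarrow> continuous_map T euclideanreal (dist_to d z)"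
    and "openin (wijsman_topology X d) \<U>"
  shows "openin T \<U>"
proof -
  have "generate_topology_on
      {{A \<in> CL X. dist_to d z A \<in> U} |z U. z \<in> topspace X \<and> open U} \<U>"
    using assms(3) unfolding wijsman_topology_def by (rule openin_topology_generated_by)
  then show ?thesis
  proof induction
    case (Basis S)
    then show ?case
      using assms(1,2) by (auto simp: continuous_map_def)
  qed auto
qed

section \<open>Borel and Souslin sets\<close>

definition borel_set_in :: "'a topology \<Rightarrow> 'a set \<Rightarrow> bool"
  where "borel_set_in T S \<longleftrightarrow> S \<in> sigma_sets (topspace T) {U. openin T U}"

text \<open>The finite sequence \<open>\<sigma>|n\<close> is represented by the list of the first \<open>n\<close> values of \<open>\<sigma>\<close>.\<close>

definition souslin_set_in :: "'a topology \<Rightarrow> 'a set \<Rightarrow> bool"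
  where "souslin_set_in T S \<longleftrightarrow>
    (\<exists>\<A> :: nat list \<Rightarrow> 'a set. (\<forall>s. borel_set_in T (\<A> s)) \<and>
       S = (\<Union>\<sigma> :: nat \<Rightarrow> nat. \<Inter>n. \<A> (map \<sigma> [0..<n])))"

section \<open>Covering dimension\<close>

definition covering_dim_le :: "'a topology \<Rightarrow> int \<Rightarrow> bool"
  where "covering_dim_le X n \<longleftrightarrow>
    (\<forall>\<U>. finite \<U> \<and> (\<forall>U\<in>\<U>. openin X U) \<and> \<Union>\<U> = topspace X \<longrightarrow>
      (\<exists>\<V>. finite \<V> \<and> (\<forall>V\<in>\<V>. openin X V) \<and> \<Union>\<V> = topspace X \<and>
           (\<forall>V\<in>\<V>. \<exists>U\<in>\<U>. V \<subseteq> U) \<and>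
           (\<forall>x\<in>topspace X. int (card {V \<in> \<V>. x \<in> V}) \<le> n + 1)))"

text \<open>The infimum is in \<open>ereal\<close>, so that it is \<open>\<infinity>\<close> if no bound \<open>n\<close> exists. The value \<open>-1\<close> is
  taken exactly by the empty space.\<close>

definition covering_dim :: "'a topology \<Rightarrow> ereal"
  where "covering_dim X = (INF n\<in>{n. -1 \<le> n \<and> covering_dim_le X n}. ereal (of_int n))"

lemma covering_dim_le_minus_one: "covering_dim_le X (-1) \<longleftrightarrow> topspace X = {}"
proof
  assume X: "covering_dim_le X (-1)"
  have "finite {topspace X} \<and> (\<forall>U\<in>{topspace X}. openin X U) \<and> \<Union>{topspace X} = topspace X"
    by simp
  then obtain \<V> where \<V>: "finite \<V>" "\<Union>\<V> = topspace X"
    "\<forall>x\<in>topspace X. int (card {V \<in> \<V>. x \<in> V}) \<le> -1 + 1"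
    using X unfolding covering_dim_le_def by metis
  then have "\<forall>x\<in>topspace X. {V \<in> \<V>. x \<in> V} = {}"
    by simp
  then show "topspace X = {}"
    using \<V>(2) by blast
next
  assume "topspace X = {}"
  then show "covering_dim_le X (-1)"
    unfolding covering_dim_le_def by (intro allI impI exI[of _ "{}"]) auto
qed

lemma covering_dim_eq_0_iff:
  "covering_dim X = 0 \<longleftrightarrow> covering_dim_le X 0 \<and> topspace X \<noteq> {}"
proof -
  let ?N = "{n. -1 \<le> n \<and> covering_dim_le X n}"
  have lower: "covering_dim X \<le> ereal (of_int n)" if "n \<in> ?N" for n
    unfolding covering_dim_def using that by (rule INF_lower)
  show ?thesis
  proof
    assume 0: "covering_dim X = 0"
    have ne: "topspace X \<noteq> {}"
      using lower[of "-1"] 0 by (auto simp: covering_dim_le_minus_one)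
    have "covering_dim X < 1"
      using 0 by simp
    then obtain n where n: "n \<in> ?N" "ereal (of_int n) < 1"
      unfolding covering_dim_def INF_less_iff by blast
    then have "n < 1"
      by simp
    moreover have "n \<noteq> -1"
      using n ne covering_dim_le_minus_one by auto
    ultimately have "n = 0"
      using n by auto
    then show "covering_dim_le X 0 \<and> topspace X \<noteq> {}"
      using n ne by auto
  next
    assume X: "covering_dim_le X 0 \<and> topspace X \<noteq> {}"
    have "0 \<le> n" if "n \<in> ?N" for n
      using that X covering_dim_le_minus_one[of X] by (cases "n = -1") auto
    then have "0 \<le> covering_dim X"
      unfolding covering_dim_def by (intro INF_greatest) auto
    moreover have "covering_dim X \<le> 0"
      using lower[of 0] X by (simp flip: zero_ereal_def)
    ultimately show "covering_dim X = 0"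
      by simp
  qed
qed

section \<open>The space \<open>\<P> \<times> I\<close>\<close>

definition unit_irrationals :: "real set"
  where "unit_irrationals = {0..1} - \<rat>"

definition PI_space :: "(real \<times> real) topology"
  where "PI_space = prod_topology (top_of_set unit_irrationals) (top_of_set {0..1})"

definition F0 :: "'a topology \<Rightarrow> 'a set set"
  where "F0 X = {A. closedin X A \<and> covering_dim (subtopology X A) = 0}"

end

theory Submission
  imports Defs
begin

text \<open>
  A closed set \<open>A\<close> in \<open>\<P> \<times> I\<close> fails to be zero-dimensional as soon as it contains a full vertical
  segment \<open>{p} \<times> I\<close>, and to detect such a segment one has to search through all
  \<open>p \<in> \<P>\<close>, that is, through all infinite sequences of naturals. So \<open>F0\<close> should be as
  complicated as the set of trees on the naturals without an infinite branch, which is coanalytic and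
  not analytic. The proof makes this a reduction.

  Continued fraction digits give a continuous surjection \<open>cf_digits\<close> from \<open>\<P>\<close> onto the sequences.
  To a tree \<open>T\<close> (any set of finite sequences) the set \<open>tree_set T\<close> is attached: above \<open>p\<close> it has
  all of \<open>I\<close> if the digits of \<open>p\<close> form a branch of \<open>T\<close>, and otherwise the first \<open>n + 1\<close> terms
  of a fixed enumeration of the rationals in \<open>I\<close>, where \<open>n\<close> is the stage at which the digits leave \<open>T\<close>. If \<open>T\<close> has a
  branch, the set contains a segment and is not zero-dimensional; otherwise it is a subset of
  irrationals times rationals, which has a countable clopen base. Hence
  \<open>tree_set T \<in> F0\<close> iff \<open>T\<close> has no branch (\<open>tree_set_in_F0_iff\<close>).

  The finite fibres exhaust a dense subset of \<open>I\<close>, so a late exit from \<open>T\<close> is hardly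
  distinguishable from a branch. That is why \<open>tree_set T\<close> meets a given open set for an open set of
  trees \<open>T\<close> (\<open>open_tree_set_meets\<close>), while with empty fibres off the branches this condition would not
  be Borel. Distances to \<open>tree_set T\<close> are therefore Borel functions of \<open>T\<close>, and, the Wijsman topology
  being determined by distances from a countable dense set, preimages of Borel sets are Borel
  (\<open>borel_preimage_tree_set\<close>).

  If \<open>F0\<close> were Souslin, the set of trees without a branch would thus come from Borel sets by the
  Souslin operation, hence be analytic (\<open>borel_imp_analytic\<close>, \<open>analytic_souslin_operation\<close>). A
  diagonal argument excludes this (\<open>wellfounded_trees_not_analytic\<close>).
\<close>

section \<open>Analytic sets\<close>

definition analytic_set :: "'a::topological_space set \<Rightarrow> bool"
  where "analytic_set S \<longleftrightarrow> (\<exists>C :: ('a \<times> (nat \<Rightarrow> nat)) set. closed C \<and> S = fst ` C)"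

lemma closed_imp_analytic: "closed S \<Longrightarrow> analytic_set S"
  unfolding analytic_set_def by (rule exI[of _ "S \<times> UNIV"]) (simp add: closed_Times)

text \<open>The witness sequence \<open>\<sigma>\<close> and, for each \<open>n\<close>, a witness for membership in \<open>\<A> (\<sigma>|n)\<close> are
  countably many sequences, so they can be merged into one sequence. The combined condition on
  the merged sequence is closed, since each \<open>\<A> (\<sigma>|n)\<close> depends on finitely many terms of \<open>\<sigma>\<close> only.\<close>

lemma analytic_souslin_operation:
  fixes \<A> :: "nat list \<Rightarrow> 'a::topological_space set"
  assumes "\<And>s. analytic_set (\<A> s)"
  shows "analytic_set (\<Union>\<sigma> :: nat \<Rightarrow> nat. \<Inter>n. \<A> (map \<sigma> [0..<n]))"
proof -
  have "\<forall>s. \<exists>C :: ('a \<times> (nat \<Rightarrow> nat)) set. closed C \<and> \<A> s = fst ` C"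
    using assms unfolding analytic_set_def by blast
  then obtain C :: "nat list \<Rightarrow> ('a \<times> (nat \<Rightarrow> nat)) set"
    where C: "\<And>s. closed (C s)" "\<And>s. \<A> s = fst ` C s"
    by metis
  \<comment> \<open>Row \<open>0\<close> of the array coded by \<open>\<rho>\<close> is \<open>\<sigma>\<close>, and row \<open>n + 1\<close> is the witness for stage \<open>n\<close>.\<close>
  define sg where "sg \<rho> i = \<rho> (prod_encode (0, i))" for \<rho> :: "nat \<Rightarrow> nat" and i
  define tau where "tau n \<rho> j = \<rho> (prod_encode (Suc n, j))" for n and \<rho> :: "nat \<Rightarrow> nat" and j
  define D where "D = {z :: 'a \<times> (nat \<Rightarrow> nat).
    \<forall>n. (fst z, tau n (snd z)) \<in> C (map (sg (snd z)) [0..<n])}"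
  have cont_coord: "continuous_on UNIV (\<lambda>z :: 'a \<times> (nat \<Rightarrow> nat). snd z k)" for k
    by (rule continuous_on_product_then_coordinatewise[OF continuous_on_snd[OF continuous_on_id]])
  \<comment> \<open>Fixing the value \<open>s\<close> of the initial segment turns \<open>D\<close> into an intersection of closed sets.\<close>
  have "D = (\<Inter>n. \<Inter>s. (if length s = n then
      (\<Union>i\<in>{..<n}. {z. sg (snd z) i \<noteq> s ! i}) \<union> {z. (fst z, tau n (snd z)) \<in> C s} else UNIV))"
    (is "_ = ?R")
  proof (intro set_eqI iffI)
    fix z assume z: "z \<in> D"
    show "z \<in> ?R"
    proof (intro INT_I)
      fix n and s :: "nat list"
      have "(fst z, tau n (snd z)) \<in> C s" if "length s = n" "\<And>i. i < n \<Longrightarrow> sg (snd z) i = s ! i"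
      proof -
        have "map (sg (snd z)) [0..<n] = s"
          using that by (intro nth_equalityI) auto
        then show ?thesis
          using z unfolding D_def by auto
      qed
      then show "z \<in> (if length s = n then (\<Union>i\<in>{..<n}. {z. sg (snd z) i \<noteq> s ! i}) \<union>
          {z. (fst z, tau n (snd z)) \<in> C s} else UNIV)"
        by auto
    qed
  next
    fix z assume z: "z \<in> ?R"
    show "z \<in> D"
      unfolding D_def
    proof (intro CollectI allI)
      fix n
      let ?s = "map (sg (snd z)) [0..<n]"
      have "z \<in> (\<Union>i\<in>{..<n}. {z. sg (snd z) i \<noteq> ?s ! i}) \<union> {z. (fst z, tau n (snd z)) \<in> C ?s}"
        using INT_D[OF INT_D[OF z, of n], of ?s] by simp
      then show "(fst z, tau n (snd z)) \<in> C ?s"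
        by auto
    qed
  qed
  moreover have "closed {z :: 'a \<times> (nat \<Rightarrow> nat). (fst z, tau n (snd z)) \<in> C s}" for n s
  proof -
    have "continuous_on UNIV (\<lambda>z :: 'a \<times> (nat \<Rightarrow> nat). (fst z, tau n (snd z)))"
      unfolding tau_def
      by (intro continuous_on_Pair continuous_on_fst continuous_on_id
          continuous_on_coordinatewise_then_product cont_coord)
    then show ?thesis
      using closed_vimage[OF C(1)] by (simp add: vimage_def)
  qed
  moreover have "closed {z :: 'a \<times> (nat \<Rightarrow> nat). sg (snd z) i \<noteq> k}" for i k
    using closed_vimage[of "-{k}", OF _ cont_coord[of "prod_encode (0, i)"]]
    by (simp add: sg_def vimage_def closed_def open_discrete)
  ultimately have "closed D"
    by (auto intro!: closed_INT closed_Un closed_UN)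
  moreover have "(\<Union>\<sigma> :: nat \<Rightarrow> nat. \<Inter>n. \<A> (map \<sigma> [0..<n])) = fst ` D" (is "?L = _")
  proof (intro set_eqI iffI)
    fix x assume "x \<in> ?L"
    then obtain \<sigma> where "\<And>n. x \<in> fst ` C (map \<sigma> [0..<n])"
      unfolding C(2) by blast
    then have "\<forall>n. \<exists>\<rho>. (x, \<rho>) \<in> C (map \<sigma> [0..<n])"
      by (metis imageE prod.collapse)
    then obtain T where T: "\<And>n. (x, T n) \<in> C (map \<sigma> [0..<n])"
      by metis
    define \<rho> where "\<rho> k = (case prod_decode k of (0, i) \<Rightarrow> \<sigma> i | (Suc n, j) \<Rightarrow> T n j)" for k
    have "sg \<rho> = \<sigma>" "tau n \<rho> = T n" for n
      by (auto simp: sg_def tau_def \<rho>_def)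
    with T have "(x, \<rho>) \<in> D"
      unfolding D_def by simp
    then show "x \<in> fst ` D"
      by (simp add: rev_image_eqI)
  next
    fix x assume "x \<in> fst ` D"
    then obtain \<rho> where \<rho>: "\<And>n. (x, tau n \<rho>) \<in> C (map (sg \<rho>) [0..<n])"
      unfolding D_def by auto
    have "x \<in> \<A> (map (sg \<rho>) [0..<n])" for n
      unfolding C(2) using imageI[OF \<rho>, of fst n] by simp
    then show "x \<in> ?L"
      by blast
  qed
  ultimately show ?thesis
    unfolding analytic_set_def by blast
qed

text \<open>Countable unions and intersections are the special cases of the Souslin operation where the
  \<open>n\<close>-th set depends only on the first term of \<open>\<sigma>\<close>, respectively only on \<open>n\<close>.\<close>

lemma analytic_UN:
  fixes S :: "nat \<Rightarrow> 'a::topological_space set"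
  assumes "\<And>n. analytic_set (S n)"
  shows "analytic_set (\<Union>n. S n)"
proof -
  define \<A> where "\<A> s = (if s = [] then UNIV else S (hd s))" for s :: "nat list"
  have "(\<Union>n. S n) = (\<Union>\<sigma>. \<Inter>n. \<A> (map \<sigma> [0..<n]))"
  proof -
    have "(\<Inter>n. \<A> (map \<sigma> [0..<n])) = S (\<sigma> 0)" for \<sigma> :: "nat \<Rightarrow> nat"
    proof -
      have "\<A> (map \<sigma> [0..<n]) = (if n = 0 then UNIV else S (\<sigma> 0))" for n
        by (auto simp: \<A>_def hd_map)
      then show ?thesis
        by (auto split: if_splits)
    qed
    then show ?thesis
      by auto
  qed
  moreover have "analytic_set (\<A> s)" for s
    using assms by (simp add: \<A>_def closed_imp_analytic)
  ultimately show ?thesis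
    using analytic_souslin_operation[of \<A>] by simp
qed

lemma analytic_INT:
  fixes S :: "nat \<Rightarrow> 'a::topological_space set"
  assumes "\<And>n. analytic_set (S n)"
  shows "analytic_set (\<Inter>n. S n)"
  using analytic_souslin_operation[of "\<lambda>s. S (length s)"] assms by simp

text \<open>Analytic sets are not closed under complement, so the induction carries both \<open>S\<close> and
  \<open>- S\<close>. Metrizability enters in the base case: open sets are countable unions of closed sets.\<close>

lemma borel_imp_analytic:
  fixes S :: "'a::topological_space set"
  assumes "metrizable_space (euclidean :: 'a topology)" "S \<in> sets borel"
  shows "analytic_set S"
proof -
  have "S \<in> sigma_sets UNIV {U. open U}"
    using assms(2) by (simp add: borel_def)
  then have "analytic_set S \<and> analytic_set (- S)"
  proof induction
    case (Basic U)
    then have "fsigma_in euclidean U"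
      using assms(1) by (simp add: open_imp_fsigma_in)
    then obtain C where C: "\<And>n :: nat. closed (C n)" "(\<Union>n. C n) = U"
      by (auto simp: fsigma_in_ascending)
    have "analytic_set (\<Union>n. C n)"
      by (intro analytic_UN closed_imp_analytic C)
    then show ?case
      using Basic C(2) by (simp add: closed_imp_analytic closed_def)
  next
    case Empty
    then show ?case
      by (simp add: closed_imp_analytic)
  next
    case (Compl U)
    then show ?case
      by (simp add: Compl_eq_Diff_UNIV Diff_Diff_Int)
  next
    case (Union U)
    have "- (\<Union>n. U n) = (\<Inter>n. - U n)"
      by blast
    then show ?case
      using Union analytic_UN[of U] analytic_INT[of "\<lambda>n. - U n"] by simp
  qed
  then show ?thesis ..
qed

section \<open>Trees without a branch\<close>

text \<open>A tree is represented by its characteristic function, whose type carries the product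
  topology.\<close>

definition branch :: "(nat list \<Rightarrow> bool) \<Rightarrow> (nat \<Rightarrow> nat) \<Rightarrow> bool"
  where "branch T \<sigma> \<longleftrightarrow> (\<forall>n. T (map \<sigma> [0..<n]))"

lemma tendsto_pointwise:
  fixes f :: "nat \<Rightarrow> 'a \<Rightarrow> 'b::topological_space"
  assumes "\<And>x. (\<lambda>n. f n x) \<longlonglongrightarrow> g x"
  shows "f \<longlonglongrightarrow> g"
  using assms limitin_componentwise[of "\<lambda>_ :: 'a. euclidean :: 'b topology" UNIV f g sequentially]
  by (simp add: euclidean_product_topology)

text \<open>If the set were the projection of a closed set \<open>C\<close>, then for each \<open>T\<close> the finite sequences
  that look, up to their length, like witnesses for \<open>T\<close> would form a tree that has a branch iff \<open>T\<close>
  has none. The value of that tree at \<open>s\<close> depends only on the values of \<open>T\<close> at shorter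
  sequences, so recursion on length produces a \<open>T\<close> equal to its own tree: a contradiction
  without universal sets.\<close>

lemma wellfounded_trees_not_analytic: "\<not> analytic_set {T. \<nexists>\<sigma>. branch T \<sigma>}"
proof
  assume "analytic_set {T. \<nexists>\<sigma>. branch T \<sigma>}"
  then obtain C :: "((nat list \<Rightarrow> bool) \<times> (nat \<Rightarrow> nat)) set"
    where C: "closed C" "{T. \<nexists>\<sigma>. branch T \<sigma>} = fst ` C"
    unfolding analytic_set_def by blast
  define near where "near T s \<longleftrightarrow>
    (\<exists>(y, \<rho>)\<in>C. map \<rho> [0..<length s] = s \<and> (\<forall>u. length u < length s \<longrightarrow> y u = T u))"
    for T :: "nat list \<Rightarrow> bool" and s
  define T where "T = wfrec (inv_image less_than length) near"
  have "near (cut T (inv_image less_than length) s) s \<longleftrightarrow> near T s" for s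
    unfolding near_def by (auto simp: cut_def)
  then have "T s \<longleftrightarrow> near T s" for s
    using wfrec[OF wf_inv_image[OF wf_less_than], of length near s, folded T_def] by blast
  then have branch_T: "branch T \<sigma> \<longleftrightarrow> (\<forall>n. near T (map \<sigma> [0..<n]))" for \<sigma>
    unfolding branch_def by blast
  have "(\<exists>\<sigma>. branch T \<sigma>) \<longleftrightarrow> T \<in> fst ` C"
  proof
    assume "T \<in> fst ` C"
    then obtain \<rho> where "(T, \<rho>) \<in> C"
      by auto
    then have "near T (map \<rho> [0..<n])" for n
      unfolding near_def by (intro bexI[of _ "(T, \<rho>)"]) auto
    then show "\<exists>\<sigma>. branch T \<sigma>"
      unfolding branch_T by blast
  next
    assume "\<exists>\<sigma>. branch T \<sigma>"
    then obtain \<sigma> where "\<And>n. near T (map \<sigma> [0..<n])"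
      unfolding branch_T by blast
    then have "\<forall>n. \<exists>y \<rho>. (y, \<rho>) \<in> C \<and> map \<rho> [0..<n] = map \<sigma> [0..<n] \<and>
        (\<forall>u. length u < n \<longrightarrow> y u = T u)"
      unfolding near_def by (simp add: case_prod_beta) (metis prod.collapse)
    then obtain y \<rho> where y: "\<And>n. (y n, \<rho> n) \<in> C"
      "\<And>n. map (\<rho> n) [0..<n] = map \<sigma> [0..<n]" "\<And>n u. length u < n \<Longrightarrow> y n u = T u"
      by metis
    \<comment> \<open>Closedness of \<open>C\<close> turns the approximate witnesses along the branch into a true one.\<close>
    have "y \<longlonglongrightarrow> T"
    proof (rule tendsto_pointwise)
      fix u
      have "eventually (\<lambda>n. y n u = T u) sequentially"
        using eventually_gt_at_top[of "length u"] by eventually_elim (rule y)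
      then show "(\<lambda>n. y n u) \<longlonglongrightarrow> T u"
        by (rule tendsto_eventually)
    qed
    moreover have "\<rho> \<longlonglongrightarrow> \<sigma>"
    proof (rule tendsto_pointwise)
      fix i
      have "eventually (\<lambda>n. \<rho> n i = \<sigma> i) sequentially"
        using eventually_gt_at_top[of i] by eventually_elim (use y(2) in \<open>simp add: map_eq_conv\<close>)
      then show "(\<lambda>n. \<rho> n i) \<longlonglongrightarrow> \<sigma> i"
        by (rule tendsto_eventually)
    qed
    ultimately have "(\<lambda>n. (y n, \<rho> n)) \<longlonglongrightarrow> (T, \<sigma>)"
      by (rule tendsto_Pair)
    then have "(T, \<sigma>) \<in> C"
      by (rule closed_sequentially[OF C(1), rotated]) (rule y(1))
    then show "T \<in> fst ` C"
      by (simp add: rev_image_eqI)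
  qed
  moreover have "T \<in> fst ` C \<longleftrightarrow> (\<nexists>\<sigma>. branch T \<sigma>)"
    unfolding C(2)[symmetric] by simp
  ultimately show False
    by blast
qed

section \<open>Continued fraction digits\<close>

definition gauss_map :: "real \<Rightarrow> real"
  where "gauss_map y = frac (1 / y)"

text \<open>The partial quotients of a continued fraction are positive; they are shifted by one so that
  every sequence of naturals occurs.\<close>

definition cf_digits :: "real \<Rightarrow> nat \<Rightarrow> nat"
  where "cf_digits p n = nat \<lfloor>1 / (gauss_map ^^ n) p\<rfloor> - 1"

lemma inverse_unit_irrational:
  assumes "y \<in> unit_irrationals"
  shows "1 / y \<notin> \<rat>" "y > 0"
proof -
  have y: "y \<notin> \<rat>" "0 \<le> y"
    using assms by (auto simp: unit_irrationals_def)
  then show "y > 0"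
    by (cases "y = 0") auto
  show "1 / y \<notin> \<rat>"
    using y Rats_divide[of 1 "1 / y"] by auto
qed

lemma gauss_map_unit_irrational:
  assumes "y \<in> unit_irrationals"
  shows "gauss_map y \<in> unit_irrationals"
proof -
  have "frac (1 / y) \<notin> \<rat>"
  proof
    assume "frac (1 / y) \<in> \<rat>"
    then have "frac (1 / y) + of_int \<lfloor>1 / y\<rfloor> \<in> \<rat>"
      by (intro Rats_add Rats_of_int)
    then show False
      using inverse_unit_irrational[OF assms] by (simp add: frac_def)
  qed
  then show ?thesis
    using frac_lt_1[of "1 / y"] by (auto simp: gauss_map_def unit_irrationals_def)
qed

text \<open>The floor function is locally constant away from the integers.\<close>

lemma continuous_on_floor_irrational:
  fixes f :: "'a::topological_space \<Rightarrow> real"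
  assumes "continuous_on S f" "\<And>x. x \<in> S \<Longrightarrow> f x \<notin> \<rat>"
  shows "continuous_on S (\<lambda>x. \<lfloor>f x\<rfloor>)"
  unfolding continuous_on_def
proof
  fix x assume x: "x \<in> S"
  have "(f \<longlongrightarrow> f x) (at x within S)"
    using assms(1) x by (auto simp: continuous_on_def)
  moreover have "f x \<notin> \<int>"
    using assms(2)[OF x] Ints_subset_Rats by blast
  ultimately show "((\<lambda>x. \<lfloor>f x\<rfloor>) \<longlongrightarrow> \<lfloor>f x\<rfloor>) (at x within S)"
    by (blast intro: tendsto_eventually eventually_floor_eq)
qed

lemma continuous_on_gauss_map: "continuous_on unit_irrationals gauss_map"
proof -
  have c: "continuous_on unit_irrationals (\<lambda>y. 1 / y :: real)"
    by (intro continuous_on_divide continuous_on_const continuous_on_id)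
       (use inverse_unit_irrational in force)
  have "continuous_on unit_irrationals (\<lambda>y. real_of_int \<lfloor>1 / y :: real\<rfloor>)"
    using continuous_on_floor_irrational[OF c] inverse_unit_irrational
    by (intro continuous_on_compose2[of UNIV real_of_int, OF Topological_Spaces.continuous_on_discrete]) auto
  then show ?thesis
    unfolding gauss_map_def frac_def by (rule continuous_on_diff[OF c])
qed

lemma funpow_gauss_map:
  "continuous_on unit_irrationals (gauss_map ^^ n)"
  "p \<in> unit_irrationals \<Longrightarrow> (gauss_map ^^ n) p \<in> unit_irrationals"
proof (induction n arbitrary: p)
  case (Suc n)
  {
    case 1
    have "continuous_on unit_irrationals (gauss_map \<circ> (gauss_map ^^ n))"
      using Suc by (intro continuous_on_compose continuous_on_subset[OF continuous_on_gauss_map]) auto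
    then show ?case
      by simp
  next
    case 2
    then show ?case
      using Suc gauss_map_unit_irrational by simp
  }
qed (auto intro: continuous_on_id)

lemma continuous_on_cf_digits: "continuous_on unit_irrationals cf_digits"
proof (rule continuous_on_coordinatewise_then_product)
  fix n
  note irr = inverse_unit_irrational[OF funpow_gauss_map(2), of _ n]
  have c: "continuous_on unit_irrationals (\<lambda>p. 1 / (gauss_map ^^ n) p)"
    by (intro continuous_on_divide continuous_on_const funpow_gauss_map(1)) (use irr in force)
  have "continuous_on unit_irrationals (\<lambda>p. \<lfloor>1 / (gauss_map ^^ n) p\<rfloor>)"
    using continuous_on_floor_irrational[OF c] irr by blast
  then have "continuous_on unit_irrationals ((\<lambda>k. nat k - 1) \<circ> (\<lambda>p. \<lfloor>1 / (gauss_map ^^ n) p\<rfloor>))"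
    by (rule continuous_on_compose) simp
  then show "continuous_on unit_irrationals (\<lambda>p. cf_digits p n)"
    by (simp add: cf_digits_def o_def)
qed

text \<open>Given digits \<open>a\<close>, the tails \<open>p n\<close> of the continued fraction are found by compactness of
  the cube: any finite part of the system of equations is solved backwards from the last equation.\<close>

lemma cf_tails_exist:
  fixes a :: "nat \<Rightarrow> nat"
  shows "\<exists>p :: nat \<Rightarrow> real. \<forall>n. 0 \<le> p n \<and> p n \<le> 1 \<and> p n * (real (Suc (a n)) + p (Suc n)) = 1"
proof -
  define Q where "Q = (PiE UNIV (\<lambda>_. {0..1}) :: (nat \<Rightarrow> real) set)"
  define K where "K n = {p :: nat \<Rightarrow> real. p n * (real (Suc (a n)) + p (Suc n)) = 1}" for n
  have "compactin (product_topology (\<lambda>_. euclidean) UNIV) Q"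
    unfolding Q_def compactin_PiE by simp
  then have "compact Q"
    by (simp add: euclidean_product_topology)
  moreover have "closed (K n)" for n
    unfolding K_def by (intro closed_Collect_eq continuous_on_mult continuous_on_add continuous_on_const
        continuous_on_product_coordinates)
  moreover have "Q \<inter> \<Inter>(K ` J) \<noteq> {}" if J: "finite J" for J
  proof -
    obtain N where N: "\<And>n. n \<in> J \<Longrightarrow> n < N"
      using J by (metis finite_nat_set_iff_bounded)
    have "\<exists>p :: nat \<Rightarrow> real. (\<forall>n. 0 \<le> p n \<and> p n \<le> 1) \<and> (\<forall>n. N - k \<le> n \<and> n < N \<longrightarrow> p \<in> K n)"
      if "k \<le> N" for k
      using that
    proof (induction k)
      case 0
      then show ?case
        by (intro exI[of _ "\<lambda>_. 0"]) auto
    next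
      case (Suc k)
      then obtain p where p: "\<forall>n. 0 \<le> p n \<and> p n \<le> (1 :: real)"
        "\<forall>n. N - k \<le> n \<and> n < N \<longrightarrow> p \<in> K n"
        by auto
      let ?m = "N - Suc k"
      have m: "Suc ?m = N - k" "?m < N"
        using Suc.prems by auto
      let ?v = "1 / (real (Suc (a ?m)) + p (Suc ?m))"
      have "0 \<le> p (Suc ?m)"
        using p by blast
      then have v: "0 \<le> ?v" "?v \<le> 1" "?v * (real (Suc (a ?m)) + p (Suc ?m)) = 1"
        by (auto simp: divide_simps)
      have "p(?m := ?v) \<in> K n" if "N - Suc k \<le> n" "n < N" for n
      proof (cases "n = ?m")
        case True
        then show ?thesis
          unfolding K_def using v(3) by simp
      next
        case False
        then have "p \<in> K n"
          using that p(2) m by auto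
        then show ?thesis
          unfolding K_def using False that by simp
      qed
      moreover have "\<forall>n. 0 \<le> (p(?m := ?v)) n \<and> (p(?m := ?v)) n \<le> 1"
        using p(1) v by simp
      ultimately show ?case
        by blast
    qed
    from this[of N] obtain p :: "nat \<Rightarrow> real"
      where "\<forall>n. 0 \<le> p n \<and> p n \<le> 1" "\<forall>n<N. p \<in> K n"
      by auto
    then have "p \<in> Q \<inter> \<Inter>(K ` J)"
      using N by (auto simp: Q_def)
    then show ?thesis
      by blast
  qed
  ultimately have "Q \<inter> \<Inter>(range K) \<noteq> {}"
    by (rule compact_imp_fip_image)
  then obtain p where "p \<in> Q" "\<And>n. p \<in> K n"
    by blast
  then show ?thesis
    by (intro exI[of _ p]) (simp add: Q_def K_def PiE_iff)
qed

text \<open>A rational tail \<open>u / v\<close> with \<open>u < v\<close> is followed by a rational tail with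
  denominator \<open>u\<close>, which gives an infinite descent.\<close>

lemma no_rational_tails:
  fixes a :: "nat \<Rightarrow> nat" and p :: "nat \<Rightarrow> real"
  assumes "\<And>n. 0 < p n \<and> p n < 1 \<and> p n * (real (Suc (a n)) + p (Suc n)) = 1"
  shows "p 0 \<notin> \<rat>"
proof -
  have "p n * real v \<noteq> real u" if "v > 0" for n u v
    using that
  proof (induction v arbitrary: n u rule: less_induct)
    case (less v)
    show ?case
    proof
      assume u: "p n * real v = real u"
      have p: "0 < p n" "p n < 1" "0 < p (Suc n)" "p n * (real (Suc (a n)) + p (Suc n)) = 1"
        using assms by blast+
      have "0 < real u" "real u < real v"
        unfolding u[symmetric] using p less.prems by simp_all
      then have uv: "0 < u" "u < v"
        by auto
      have eq: "p (Suc n) * real u = real v - real (Suc (a n) * u)"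
      proof -
        have "real v = real v * (p n * (real (Suc (a n)) + p (Suc n)))"
          using p(4) by simp
        also have "\<dots> = real u * (real (Suc (a n)) + p (Suc n))"
          unfolding u[symmetric] by (simp only: ac_simps)
        finally show ?thesis
          by (simp add: algebra_simps)
      qed
      moreover have "0 < p (Suc n) * real u"
        using p uv by simp
      ultimately have "Suc (a n) * u \<le> v"
        by linarith
      then have "p (Suc n) * real u = real (v - Suc (a n) * u)"
        unfolding eq by (rule of_nat_diff[symmetric])
      then show False
        using less.IH[OF uv(2,1)] by blast
    qed
  qed
  note * = this
  show ?thesis
  proof
    assume "p 0 \<in> \<rat>"
    then obtain m n :: nat where "n \<noteq> 0" "\<bar>p 0\<bar> = real m / real n"
      by (rule Rats_abs_nat_div_natE)
    then have "p 0 = real m / real n"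
      using conjunct1[OF assms[of 0]] by simp
    then have "p 0 * real n = real m"
      using \<open>n \<noteq> 0\<close> by simp
    then show False
      using * \<open>n \<noteq> 0\<close> by blast
  qed
qed

lemma cf_digits_surj: "cf_digits ` unit_irrationals = UNIV"
proof -
  have "\<sigma> \<in> cf_digits ` unit_irrationals" for \<sigma>
  proof -
    obtain p :: "nat \<Rightarrow> real" where p: "\<And>n. 0 \<le> p n" "\<And>n. p n \<le> 1"
      "\<And>n. p n * (real (Suc (\<sigma> n)) + p (Suc n)) = 1"
      using cf_tails_exist[of \<sigma>] by auto
    have pos: "0 < p n" for n
      using p(1)[of n] p(3)[of n] by (cases "p n = 0") auto
    have less: "p n < 1" for n
    proof (rule ccontr)
      assume "\<not> p n < 1"
      then have "p n = 1"
        using p(2)[of n] by simp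
      then show False
        using p(3)[of n] pos[of "Suc n"] by simp
    qed
    have inv: "1 / p n = real (Suc (\<sigma> n)) + p (Suc n)" for n
      using p(3)[of n] pos[of n] by (simp add: field_simps)
    have fl: "\<lfloor>1 / p n\<rfloor> = int (Suc (\<sigma> n))" for n
      unfolding inv using pos[of "Suc n"] less[of "Suc n"] by (simp add: floor_eq_iff)
    have iter: "(gauss_map ^^ n) (p 0) = p n" for n
    proof (induction n)
      case (Suc n)
      have "gauss_map (p n) = p (Suc n)"
        unfolding gauss_map_def frac_def fl unfolding inv by simp
      with Suc show ?case
        by simp
    qed simp
    have "p 0 \<notin> \<rat>"
      using no_rational_tails[of p \<sigma>] pos less p(3) by blast
    then have "p 0 \<in> unit_irrationals"
      using p by (simp add: unit_irrationals_def)
    moreover have "cf_digits (p 0) = \<sigma>"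
      by (rule ext) (simp add: cf_digits_def iter fl)
    ultimately show ?thesis
      by blast
  qed
  then show ?thesis
    by blast
qed

section \<open>Dimension zero\<close>

text \<open>Countably many clopen sets subordinate to the cover can be made disjoint by subtracting from
  each one its predecessors. Grouping the pieces by a member of the cover containing them leaves
  finitely many disjoint open sets.\<close>

lemma covering_dim_le_0_if_clopen_base:
  assumes "countable \<B>" "\<And>B. B \<in> \<B> \<Longrightarrow> openin X B" "\<And>B. B \<in> \<B> \<Longrightarrow> closedin X B"
    and base: "\<And>U x. openin X U \<Longrightarrow> x \<in> U \<Longrightarrow> \<exists>B\<in>\<B>. x \<in> B \<and> B \<subseteq> U"
  shows "covering_dim_le X 0"
  unfolding covering_dim_le_def
proof (intro allI impI)
  fix \<U> :: "'a set set"
  assume \<U>: "finite \<U> \<and> (\<forall>U\<in>\<U>. openin X U) \<and> \<Union>\<U> = topspace X"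
  define \<B>' where "\<B>' = insert {} {B \<in> \<B>. \<exists>U\<in>\<U>. B \<subseteq> U}"
  have "countable \<B>'"
    using assms(1) by (simp add: \<B>'_def)
  moreover have "\<B>' \<noteq> {}"
    by (simp add: \<B>'_def)
  ultimately have "range (from_nat_into \<B>') = \<B>'"
    by (simp add: range_from_nat_into)
  then obtain B :: "nat \<Rightarrow> 'a set" where B: "range B = \<B>'"
    by (rule that)
  have mem: "B n = {} \<or> B n \<in> \<B> \<and> (\<exists>U\<in>\<U>. B n \<subseteq> U)" for n
  proof -
    have "B n \<in> \<B>'"
      using B by blast
    then show ?thesis
      unfolding \<B>'_def by blast
  qed
  have cov: "\<exists>n. x \<in> B n" if x: "x \<in> topspace X" for x
  proof -
    obtain U where "U \<in> \<U>" "x \<in> U"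
      using \<U> x by blast
    then obtain V where "V \<in> \<B>" "x \<in> V" "V \<subseteq> U"
      using base \<U> by blast
    then have "V \<in> \<B>'"
      using \<open>U \<in> \<U>\<close> by (auto simp: \<B>'_def)
    then show ?thesis
      using B \<open>x \<in> V\<close> by (metis imageE)
  qed
  define D where "D n = B n - (\<Union>m<n. B m)" for n
  have clopen: "openin X (B n)" "closedin X (B n)" for n
    using mem[of n] assms(2,3) by auto
  then have D_open: "openin X (D n)" for n
    unfolding D_def by (intro openin_diff closedin_Union) auto
  have "\<not> m < n" if "x \<in> D m" "x \<in> D n" for x m n
    using that unfolding D_def by blast
  then have D_disj: "m = n" if "x \<in> D m" "x \<in> D n" for x m n
    using that by (meson linorder_neqE_nat)
  have D_cov: "\<exists>n. x \<in> D n" if "x \<in> topspace X" for x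
  proof
    show "x \<in> D (LEAST n. x \<in> B n)"
      unfolding D_def using LeastI_ex[OF cov[OF that]] not_less_Least by blast
  qed
  have "\<forall>n. \<exists>U. D n = {} \<or> U \<in> \<U> \<and> D n \<subseteq> U"
  proof
    fix n
    have "D n \<subseteq> B n"
      unfolding D_def by (rule Diff_subset)
    then show "\<exists>U. D n = {} \<or> U \<in> \<U> \<and> D n \<subseteq> U"
      using mem[of n] by blast
  qed
  then obtain u where u: "\<And>n. D n = {} \<or> u n \<in> \<U> \<and> D n \<subseteq> u n"
    by metis
  define V where "V U = (\<Union>n\<in>{n. u n = U}. D n)" for U
  have V_sub: "V U \<subseteq> U" for U
    unfolding V_def using u by fastforce
  have V_disj: "U = U'" if "x \<in> V U" "x \<in> V U'" for x U U'
    using that D_disj unfolding V_def by blast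
  have V_open: "openin X (V U)" for U
    unfolding V_def using D_open by blast
  have "\<Union>(V ` \<U>) = topspace X"
  proof
    show "\<Union>(V ` \<U>) \<subseteq> topspace X"
      using openin_subset[OF V_open] by blast
    show "topspace X \<subseteq> \<Union>(V ` \<U>)"
    proof
      fix x assume "x \<in> topspace X"
      then obtain n where "x \<in> D n"
        using D_cov by blast
      then show "x \<in> \<Union>(V ` \<U>)"
        using u[of n] by (auto simp: V_def)
    qed
  qed
  moreover have "\<forall>x\<in>topspace X. int (card {W \<in> V ` \<U>. x \<in> W}) \<le> 0 + 1"
  proof
    fix x
    have "W = W'" if "W \<in> {W \<in> V ` \<U>. x \<in> W}" "W' \<in> {W \<in> V ` \<U>. x \<in> W}" for W W'
      using that V_disj by blast
    then have "card {W \<in> V ` \<U>. x \<in> W} \<le> 1"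
      using card_le_Suc0_iff_eq[of "{W \<in> V ` \<U>. x \<in> W}"] \<U> by auto
    then show "int (card {W \<in> V ` \<U>. x \<in> W}) \<le> 0 + 1"
      by simp
  qed
  moreover have "finite (V ` \<U>)" "\<forall>W\<in>V ` \<U>. openin X W" "\<forall>W\<in>V ` \<U>. \<exists>U\<in>\<U>. W \<subseteq> U"
    using \<U> V_open V_sub by auto
  ultimately show "\<exists>\<V>. finite \<V> \<and> (\<forall>V\<in>\<V>. openin X V) \<and> \<Union>\<V> = topspace X \<and>
      (\<forall>V\<in>\<V>. \<exists>U\<in>\<U>. V \<subseteq> U) \<and> (\<forall>x\<in>topspace X. int (card {V \<in> \<V>. x \<in> V}) \<le> 0 + 1)"
    by (intro exI[of _ "V ` \<U>"] conjI)
qed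

text \<open>Boxes with rational first and irrational second coordinates of their corners have boundaries
  disjoint from \<open>A\<close>.\<close>

lemma covering_dim_le_0_irrational_times_rational:
  fixes A :: "(real \<times> real) set"
  assumes A: "A \<subseteq> (- \<rat>) \<times> \<rat>"
  shows "covering_dim_le (top_of_set A) 0"
proof -
  obtain r where "r \<in> unit_irrationals"
    using cf_digits_surj by blast
  then have r: "r \<notin> \<rat>"
    by (simp add: unit_irrationals_def)
  \<comment> \<open>A countable dense set of irrationals for the second coordinates of the corners.\<close>
  define Q' :: "real set" where "Q' = (\<lambda>q. q + r) ` \<rat>"
  have Q'_irr: "c \<notin> \<rat>" if c': "c \<in> Q'" for c
  proof
    assume c: "c \<in> \<rat>"
    obtain q where "q \<in> \<rat>" "c = q + r"
      using c' unfolding Q'_def by blast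
    then show False
      using Rats_diff[OF c, of q] r by simp
  qed
  have Q'_dense: "\<exists>c\<in>Q'. x < c \<and> c < y" if "x < y" for x y
  proof -
    have "x - r < y - r"
      using that by simp
    then obtain q where "q \<in> \<rat>" "x - r < q" "q < y - r"
      using Rats_dense_in_real by blast
    then show ?thesis
      unfolding Q'_def by (intro bexI[of _ "q + r"]) auto
  qed
  define \<B> where "\<B> = (\<lambda>(a, b, c, e). A \<inter> ({a<..<b} \<times> {c<..<e})) ` (\<rat> \<times> \<rat> \<times> Q' \<times> Q')"
  have "countable \<B>"
    unfolding \<B>_def Q'_def by (intro countable_image countable_SIGMA countable_rat)
  moreover have "openin (top_of_set A) B" if "B \<in> \<B>" for B
    using that unfolding \<B>_def by (auto intro!: openin_open_Int open_Times)
  moreover have "closedin (top_of_set A) B" if "B \<in> \<B>" for B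
  proof -
    obtain a b c e where B: "B = A \<inter> ({a<..<b} \<times> {c<..<e})"
      and ab: "a \<in> \<rat>" "b \<in> \<rat>" "c \<in> Q'" "e \<in> Q'"
      using \<open>B \<in> \<B>\<close> unfolding \<B>_def by auto
    have "p \<noteq> a \<and> p \<noteq> b \<and> t \<noteq> c \<and> t \<noteq> e" if "(p, t) \<in> A" for p t
      using that A ab Q'_irr by blast
    then have "x \<in> {a<..<b} \<times> {c<..<e} \<longleftrightarrow> x \<in> {a..b} \<times> {c..e}" if "x \<in> A" for x
      using that by (cases x) (auto simp: less_le)
    then have "B = A \<inter> ({a..b} \<times> {c..e})"
      unfolding B by blast
    then show ?thesis
      by (simp add: closedin_closed_Int closed_Times)
  qed
  moreover have "\<exists>B\<in>\<B>. z \<in> B \<and> B \<subseteq> U" if U: "openin (top_of_set A) U" "z \<in> U" for U z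
  proof -
    obtain O' where O': "open O'" "U = A \<inter> O'"
      using U(1) unfolding openin_open by blast
    obtain p t where z: "z = (p, t)"
      by force
    have "(p, t) \<in> O'"
      using U(2) O'(2) z by blast
    then obtain S T where "open S" "open T" "(p, t) \<in> S \<times> T" "S \<times> T \<subseteq> O'"
      by (rule open_prod_elim[OF O'(1)])
    then have ST: "open S" "open T" "p \<in> S" "t \<in> T" "S \<times> T \<subseteq> O'"
      by auto
    obtain \<epsilon> where \<epsilon>: "\<epsilon> > 0" "ball p \<epsilon> \<subseteq> S"
      using ST open_contains_ball by metis
    obtain \<delta> where \<delta>: "\<delta> > 0" "ball t \<delta> \<subseteq> T"
      using ST open_contains_ball by metis
    have less: "p - \<epsilon> < p" "p < p + \<epsilon>" "t - \<delta> < t" "t < t + \<delta>"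
      using \<epsilon>(1) \<delta>(1) by simp_all
    obtain a b where ab: "a \<in> \<rat>" "b \<in> \<rat>" "p - \<epsilon> < a" "a < p" "p < b" "b < p + \<epsilon>"
      using Rats_dense_in_real[OF less(1)] Rats_dense_in_real[OF less(2)] by blast
    obtain c e where ce: "c \<in> Q'" "e \<in> Q'" "t - \<delta> < c" "c < t" "t < e" "e < t + \<delta>"
      using Q'_dense[OF less(3)] Q'_dense[OF less(4)] by blast
    have "{a<..<b} \<subseteq> ball p \<epsilon>" "{c<..<e} \<subseteq> ball t \<delta>"
      using ab ce by (auto simp: dist_real_def)
    then have "{a<..<b} \<times> {c<..<e} \<subseteq> S \<times> T"
      using \<epsilon>(2) \<delta>(2) by (intro Sigma_mono) auto
    then have "A \<inter> ({a<..<b} \<times> {c<..<e}) \<subseteq> U"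
      using ST(5) O'(2) by blast
    moreover have "z \<in> A \<inter> ({a<..<b} \<times> {c<..<e})"
      using U(2) O' z ab ce by auto
    moreover have "A \<inter> ({a<..<b} \<times> {c<..<e}) \<in> \<B>"
      unfolding \<B>_def using ab ce by (intro image_eqI[of _ _ "(a, b, c, e)"]) auto
    ultimately show ?thesis
      by (intro bexI[of _ "A \<inter> ({a<..<b} \<times> {c<..<e})"] conjI)
  qed
  ultimately show ?thesis
    by (rule covering_dim_le_0_if_clopen_base)
qed

text \<open>A disjoint open refinement cannot split the connected segment, so one of its members contains
  both ends; but no member of the cover does.\<close>

lemma covering_dim_le_0_segment:
  assumes "covering_dim_le (top_of_set A) 0" "{p} \<times> {0..1 :: real} \<subseteq> A"
  shows False
proof -
  let ?\<U> = "{A \<inter> {z. snd z < 1}, A \<inter> {z. 0 < snd z}}"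
  have "openin (top_of_set A) U" if "U \<in> ?\<U>" for U
  proof -
    have "open {z :: 'a \<times> real. snd z < 1}" "open {z :: 'a \<times> real. 0 < snd z}"
      by (intro open_Collect_less continuous_on_snd continuous_on_const continuous_on_id)+
    then show ?thesis
      using that by (auto intro: openin_open_Int)
  qed
  moreover have "\<Union>?\<U> = A"
    by auto
  ultimately have "finite ?\<U> \<and> (\<forall>U\<in>?\<U>. openin (top_of_set A) U) \<and> \<Union>?\<U> = topspace (top_of_set A)"
    by simp
  then have "\<exists>\<V>. finite \<V> \<and> (\<forall>V\<in>\<V>. openin (top_of_set A) V) \<and>
      \<Union>\<V> = topspace (top_of_set A) \<and> (\<forall>V\<in>\<V>. \<exists>U\<in>?\<U>. V \<subseteq> U) \<and>
      (\<forall>x\<in>topspace (top_of_set A). int (card {V \<in> \<V>. x \<in> V}) \<le> 0 + 1)"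
    using assms(1) unfolding covering_dim_le_def by blast
  then obtain \<V> where *: "finite \<V> \<and> (\<forall>V\<in>\<V>. openin (top_of_set A) V) \<and>
      \<Union>\<V> = topspace (top_of_set A) \<and> (\<forall>V\<in>\<V>. \<exists>U\<in>?\<U>. V \<subseteq> U) \<and>
      (\<forall>x\<in>topspace (top_of_set A). int (card {V \<in> \<V>. x \<in> V}) \<le> 0 + 1)"
    by (rule exE)
  then have \<V>: "finite \<V>" "\<And>V. V \<in> \<V> \<Longrightarrow> openin (top_of_set A) V" "\<Union>\<V> = A"
    "\<And>V. V \<in> \<V> \<Longrightarrow> \<exists>U\<in>?\<U>. V \<subseteq> U" "\<And>x. x \<in> A \<Longrightarrow> int (card {V \<in> \<V>. x \<in> V}) \<le> 0 + 1"
    unfolding topspace_euclidean_subtopology by (rule conjE; blast)+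
  have disj: "V = W" if "V \<in> \<V>" "W \<in> \<V>" "x \<in> V" "x \<in> W" for V W x
  proof -
    have "x \<in> A"
      using that \<V>(3) by blast
    then have "card {V \<in> \<V>. x \<in> V} \<le> Suc 0"
      using \<V>(5)[of x] by simp
    then show ?thesis
      using card_le_Suc0_iff_eq[of "{V \<in> \<V>. x \<in> V}"] \<V>(1) that by auto
  qed
  let ?L = "{p} \<times> {0..1 :: real}"
  have conn: "connected ?L"
    by (intro connected_Times) auto
  have "(p, 0) \<in> A"
    using assms(2) by auto
  then obtain V where V: "V \<in> \<V>" "(p, 0) \<in> V"
    using \<V>(3) by blast
  let ?W = "\<Union>(\<V> - {V})"
  have "openin (top_of_set ?L) (?L \<inter> V)" "openin (top_of_set ?L) (?L \<inter> ?W)"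
  proof -
    have "openin (top_of_set A) V" "openin (top_of_set A) ?W"
      using V(1) \<V>(2) by (auto intro: openin_Union)
    moreover have "openin (top_of_set ?L) (?L \<inter> S)" if "openin (top_of_set A) S" for S
      using that assms(2) unfolding openin_open by blast
    ultimately show "openin (top_of_set ?L) (?L \<inter> V)" "openin (top_of_set ?L) (?L \<inter> ?W)"
      by blast+
  qed
  moreover have "(?L \<inter> V) \<union> (?L \<inter> ?W) = ?L"
    using assms(2) \<V>(3) by blast
  moreover have "(?L \<inter> V) \<inter> (?L \<inter> ?W) = {}"
    using disj V(1) by blast
  moreover have "(p, 0) \<in> ?L \<inter> V"
    using V by simp
  ultimately have "?L \<inter> ?W = {}"
    using conn unfolding connected_openin_eq by (metis empty_iff)
  then have "?L \<subseteq> V"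
    using assms(2) \<V>(3) by blast
  then have "(p, 0) \<in> V" "(p, 1) \<in> V"
    by auto
  moreover obtain U where "U \<in> ?\<U>" "V \<subseteq> U"
    using \<V>(4) V(1) by blast
  ultimately show False
    by auto
qed

section \<open>The closed set of a tree\<close>

definition unit_rational :: "nat \<Rightarrow> real"
  where "unit_rational = from_nat_into (\<rat> \<inter> {0..1})"

lemma range_unit_rational: "range unit_rational = \<rat> \<inter> {0..1}"
  unfolding unit_rational_def
  by (rule range_from_nat_into) (auto intro: countable_Int1 countable_rat simp: exI[of _ 0])

text \<open>The rationals grow with \<open>n\<close>, so the first \<open>n\<close> at which the digits of \<open>p\<close> leave \<open>T\<close>
  imposes the strongest condition on \<open>t\<close>. The range \<open>{..n}\<close> is nonempty even for \<open>n = 0\<close>, so no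
  fibre is empty.\<close>

definition tree_set :: "(nat list \<Rightarrow> bool) \<Rightarrow> (real \<times> real) set"
  where "tree_set T = {(p, t) \<in> unit_irrationals \<times> {0..1}.
    \<forall>n. \<not> T (map (cf_digits p) [0..<n]) \<longrightarrow> t \<in> unit_rational ` {..n}}"

lemma PI_space_eq: "PI_space = top_of_set (unit_irrationals \<times> {0..1})"
  by (simp add: PI_space_def)

text \<open>The restrictions from stage \<open>j\<close> on allow \<open>unit_rational j\<close>, so membership of this point
  depends on finitely many values of \<open>T\<close>.\<close>

lemma tree_set_rational_iff:
  "(p, unit_rational j) \<in> tree_set T \<longleftrightarrow>
    p \<in> unit_irrationals \<and> (\<forall>n<j. \<not> T (map (cf_digits p) [0..<n]) \<longrightarrow> unit_rational j \<in> unit_rational ` {..n})"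
proof -
  have "unit_rational j \<in> {0..1}"
    using range_unit_rational by blast
  then show ?thesis
    unfolding tree_set_def by (auto simp: not_less) (metis atMost_iff image_eqI not_less)
qed

lemma continuous_on_initial_segment:
  fixes f :: "'a::topological_space \<Rightarrow> nat \<Rightarrow> nat" and g :: "nat list \<Rightarrow> bool"
  assumes "continuous_on S f"
  shows "continuous_on S (\<lambda>x. g (map (f x) [0..<n]))"
  unfolding continuous_on_def
proof
  fix x assume x: "x \<in> S"
  have "\<forall>\<^sub>F y in at x within S. f y i = f x i" for i
    using continuous_on_product_then_coordinatewise[OF assms, of i] x
    by (simp add: continuous_on_def tendsto_discrete)
  then have "\<forall>\<^sub>F y in at x within S. \<forall>i\<in>{..<n}. f y i = f x i"
    by (intro eventually_ball_finite) auto
  then have "\<forall>\<^sub>F y in at x within S. g (map (f y) [0..<n]) = g (map (f x) [0..<n])"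
    by eventually_elim (intro arg_cong[of _ _ g] map_cong, auto)
  then show "((\<lambda>y. g (map (f y) [0..<n])) \<longlongrightarrow> g (map (f x) [0..<n])) (at x within S)"
    by (rule tendsto_eventually)
qed

lemma tree_set_in_CL: "tree_set T \<in> CL PI_space"
proof -
  let ?PI = "unit_irrationals \<times> {0..1 :: real}"
  have c: "continuous_on ?PI (\<lambda>z. cf_digits (fst z) i)" for i
    by (rule continuous_on_compose2[OF continuous_on_product_then_coordinatewise[OF continuous_on_cf_digits]
          continuous_on_fst[OF continuous_on_id]]) auto
  have 0: "continuous_on ?PI (\<lambda>z. T (map (cf_digits (fst z)) [0..<n]))" for n
    by (intro continuous_on_initial_segment continuous_on_coordinatewise_then_product c)
  have "closedin (top_of_set ?PI)
    {z \<in> ?PI. T (map (cf_digits (fst z)) [0..<n]) \<or> snd z \<in> unit_rational ` {..n}}" for n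
  proof -
    have "closedin (top_of_set ?PI) (?PI \<inter> (\<lambda>z. T (map (cf_digits (fst z)) [0..<n])) -` {True})"
      by (intro continuous_closedin_preimage 0) (simp add: closed_def open_discrete)
    moreover have "closedin (top_of_set ?PI) (?PI \<inter> snd -` (unit_rational ` {..n}))"
      by (intro continuous_closedin_preimage continuous_on_snd continuous_on_id finite_imp_closed
          finite_imageI finite_atMost)
    ultimately have "closedin (top_of_set ?PI)
      ((?PI \<inter> (\<lambda>z. T (map (cf_digits (fst z)) [0..<n])) -` {True}) \<union>
       (?PI \<inter> snd -` (unit_rational ` {..n})))"
      by (rule closedin_Un)
    then show ?thesis
      by (rule back_subst[of "closedin (top_of_set ?PI)"]) auto
  qed
  note 1 = this
  have "closedin (top_of_set ?PI) (\<Inter>n. {z \<in> ?PI. T (map (cf_digits (fst z)) [0..<n]) \<or> snd z \<in> unit_rational ` {..n}})"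
    by (intro closedin_INT 1) auto
  moreover have "(\<Inter>n. {z \<in> ?PI. T (map (cf_digits (fst z)) [0..<n]) \<or> snd z \<in> unit_rational ` {..n}}) = tree_set T"
    unfolding tree_set_def by (auto; blast)
  moreover obtain p where "p \<in> unit_irrationals"
    using cf_digits_surj by blast
  then have "(p, unit_rational 0) \<in> tree_set T"
    by (simp add: tree_set_rational_iff)
  ultimately show ?thesis
    unfolding CL_def PI_space_eq by auto
qed

lemma tree_set_in_F0_iff: "tree_set T \<in> F0 PI_space \<longleftrightarrow> (\<nexists>\<sigma>. branch T \<sigma>)"
proof -
  have CL: "closedin PI_space (tree_set T)" "tree_set T \<noteq> {}"
    using tree_set_in_CL by (auto simp: CL_def)
  have sub: "tree_set T \<subseteq> unit_irrationals \<times> {0..1}"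
    unfolding tree_set_def by auto
  then have top: "subtopology PI_space (tree_set T) = top_of_set (tree_set T)"
    by (simp add: PI_space_eq subtopology_subtopology inf_absorb2)
  have "covering_dim_le (top_of_set (tree_set T)) 0 \<longleftrightarrow> (\<nexists>\<sigma>. branch T \<sigma>)"
  proof
    assume dim: "covering_dim_le (top_of_set (tree_set T)) 0"
    show "\<nexists>\<sigma>. branch T \<sigma>"
    proof
      assume "\<exists>\<sigma>. branch T \<sigma>"
      then obtain \<sigma> where \<sigma>: "branch T \<sigma>"
        by blast
      obtain p where p: "p \<in> unit_irrationals" "cf_digits p = \<sigma>"
        using cf_digits_surj by (metis UNIV_I imageE)
      then have "{p} \<times> {0..1} \<subseteq> tree_set T"
        using \<sigma> unfolding tree_set_def branch_def by auto
      then show False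
        using covering_dim_le_0_segment[OF dim] by blast
    qed
  next
    assume nb: "\<nexists>\<sigma>. branch T \<sigma>"
    have "tree_set T \<subseteq> (- \<rat>) \<times> \<rat>"
    proof clarify
      fix p t assume pt: "(p, t) \<in> tree_set T"
      obtain n where "\<not> T (map (cf_digits p) [0..<n])"
        using nb unfolding branch_def by blast
      then have "t \<in> range unit_rational"
        using pt unfolding tree_set_def by blast
      then show "p \<in> - \<rat> \<and> t \<in> \<rat>"
        using pt range_unit_rational by (auto simp: tree_set_def unit_irrationals_def)
    qed
    then show "covering_dim_le (top_of_set (tree_set T)) 0"
      by (rule covering_dim_le_0_irrational_times_rational)
  qed
  then show ?thesis
    unfolding F0_def covering_dim_eq_0_iff mem_Collect_eq top using CL by simp
qed

text \<open>If \<open>tree_set T\<close> meets \<open>U\<close>, it does so at a point with rational height: the only other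
  points lie on full segments, where the height can be moved slightly. For such a point, membership
  in \<open>tree_set T\<close> is an open condition on \<open>T\<close>.\<close>

lemma open_tree_set_meets:
  assumes "openin PI_space U"
  shows "open {T. tree_set T \<inter> U \<noteq> {}}"
proof -
  obtain O' where O': "open O'" "U = (unit_irrationals \<times> {0..1}) \<inter> O'"
    using assms unfolding PI_space_eq openin_open by blast
  have rational_pt: "\<exists>j. (p, unit_rational j) \<in> tree_set T \<inter> U" if pt: "(p, t) \<in> tree_set T" "(p, t) \<in> U" for p t T
  proof (cases "t \<in> range unit_rational")
    case True
    then show ?thesis
      using that by blast
  next
    case False
    then have all: "T (map (cf_digits p) [0..<n])" for n
      using pt(1) unfolding tree_set_def by blast
    \<comment> \<open>The height is irrational, hence below \<open>1\<close>, so there is room to move up.\<close>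
    have "t \<in> {0..1}" "p \<in> unit_irrationals"
      using pt(1) by (auto simp: tree_set_def)
    moreover have "t \<noteq> 1"
      using False unfolding range_unit_rational by auto
    ultimately have t: "0 \<le> t" "t < 1" "p \<in> unit_irrationals"
      by auto
    obtain S V where SV: "open S" "open V" "p \<in> S" "t \<in> V" "S \<times> V \<subseteq> O'"
      using open_prod_elim[OF O'(1)] pt(2) O'(2) by (metis IntD2 mem_Sigma_iff)
    obtain \<delta> where \<delta>: "\<delta> > 0" "ball t \<delta> \<subseteq> V"
      using SV open_contains_ball by metis
    obtain q where q: "q \<in> \<rat>" "t < q" "q < min 1 (t + \<delta>)"
      using Rats_dense_in_real[of t "min 1 (t + \<delta>)"] t \<delta> by auto
    then have "q \<in> range unit_rational"
      using t unfolding range_unit_rational by auto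
    then obtain j where j: "q = unit_rational j"
      by blast
    have "q \<in> V"
      using q \<delta> by (auto simp: dist_real_def subset_iff)
    then have "(p, q) \<in> U"
      using SV O'(2) t q by auto
    moreover have "(p, q) \<in> tree_set T"
      using t q by (auto simp: all tree_set_def)
    ultimately show ?thesis
      unfolding j by blast
  qed
  have "{T. tree_set T \<inter> U \<noteq> {}} =
    (\<Union>(p, j)\<in>{(p, j). (p, unit_rational j) \<in> U}. {T. (p, unit_rational j) \<in> tree_set T})"
    (is "_ = ?R")
  proof
    show "{T. tree_set T \<inter> U \<noteq> {}} \<subseteq> ?R"
    proof
      fix T assume "T \<in> {T. tree_set T \<inter> U \<noteq> {}}"
      then obtain p t where "(p, t) \<in> tree_set T" "(p, t) \<in> U"
        by auto
      then obtain j where "(p, unit_rational j) \<in> tree_set T \<inter> U"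
        using rational_pt by blast
      then show "T \<in> ?R"
        by blast
    qed
    show "?R \<subseteq> {T. tree_set T \<inter> U \<noteq> {}}"
      by blast
  qed
  moreover have "open {T. (p, unit_rational j) \<in> tree_set T}" if "p \<in> unit_irrationals" for p j
  proof -
    have "open {T :: nat list \<Rightarrow> bool. \<not> T s \<longrightarrow> P}" for s P
    proof -
      have "open ((\<lambda>T :: nat list \<Rightarrow> bool. T s) -` {b. \<not> b \<longrightarrow> P})"
        by (intro open_vimage open_discrete continuous_on_product_coordinates)
      then show ?thesis
        by (simp add: vimage_def)
    qed
    note 1 = this
    have "open (\<Inter>n\<in>{..<j}. {T. \<not> T (map (cf_digits p) [0..<n]) \<longrightarrow> unit_rational j \<in> unit_rational ` {..n}})"
      by (intro open_INT ballI 1) auto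
    moreover have "{T. (p, unit_rational j) \<in> tree_set T} = (\<Inter>n\<in>{..<j}. {T. \<not> T (map (cf_digits p) [0..<n]) \<longrightarrow> unit_rational j \<in> unit_rational ` {..n}})"
      using that unfolding tree_set_rational_iff by auto
    ultimately show ?thesis
      by simp
  qed
  ultimately show ?thesis
    using O'(2) by (auto intro!: open_UN)
qed

section \<open>Measurability of the reduction\<close>

text \<open>Since \<open>dist_to d z\<close> changes by at most \<open>d y z\<close> when \<open>z\<close> is replaced by \<open>y\<close>, it is a uniform limit
  of the distances from points of a dense sequence. So all of them are continuous for the topology
  induced by these countably many distances, and the Wijsman topology, as the weakest such
  topology, is contained in it. This reduction to countable data is what makes preimages of
  arbitrary open sets measurable.\<close>

lemma wijsman_open_from_countable_data:
  fixes D :: "nat \<Rightarrow> 'a"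
  assumes "Metric_space (topspace X) d"
    and D: "range D \<subseteq> topspace X"
      "\<And>z e. z \<in> topspace X \<Longrightarrow> e > 0 \<Longrightarrow> \<exists>n. d z (D n) < e"
    and "openin (wijsman_topology X d) \<U>"
  shows "\<exists>V. open V \<and> \<U> = {A \<in> CL X. (\<lambda>n. dist_to d (D n) A) \<in> V}"
proof -
  interpret Metric_space "topspace X" d by fact
  define \<Psi> where "\<Psi> A = (\<lambda>n. dist_to d (D n) A)" for A
  define \<T> where "\<T> = pullback_topology (CL X) \<Psi> (euclidean :: (nat \<Rightarrow> real) topology)"
  have top: "topspace \<T> = CL X"
    by (simp add: \<T>_def topspace_pullback_topology)
  have lip: "dist_to d z A \<le> dist_to d y A + d y z"
    if A: "A \<in> CL X" and z: "z \<in> topspace X" "y \<in> topspace X" for z y A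
  proof -
    have ne: "A \<noteq> {}" and sub: "A \<subseteq> topspace X"
      using A closedin_subset by (auto simp: CL_def)
    have "dist_to d z A - d y z \<le> d y a" if a: "a \<in> A" for a
    proof -
      have "bdd_below (d z ` A)"
        by (rule bdd_belowI[of _ 0]) auto
      then have "dist_to d z A \<le> d z a"
        unfolding dist_to_def using a by (rule cINF_lower)
      also have "\<dots> \<le> d z y + d y a"
        using triangle z a sub by blast
      finally show ?thesis
        by (simp add: commute)
    qed
    then have "dist_to d z A - d y z \<le> dist_to d y A"
      unfolding dist_to_def by (intro cINF_greatest ne)
    then show ?thesis
      by simp
  qed
  have "continuous_map \<T> euclideanreal (dist_to d z)" if z: "z \<in> topspace X" for z
  proof -
    have coord: "continuous_map \<T> euclideanreal (dist_to d (D n))" for n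
    proof -
      have "continuous_map \<T> euclideanreal ((\<lambda>x. x n) \<circ> \<Psi>)"
        unfolding \<T>_def by (rule continuous_map_pullback) (simp add: continuous_on_product_coordinates)
      then show ?thesis
        by (simp add: \<Psi>_def o_def)
    qed
    have nbhd: "\<exists>W. openin \<T> W \<and> A \<in> W \<and> (\<forall>B\<in>W. \<bar>dist_to d z B - dist_to d z A\<bar> < e)"
      if A: "A \<in> CL X" and e: "e > 0" for A e
    proof -
      obtain n where n: "d z (D n) < e / 3"
        using D(2)[OF z, of "e / 3"] e by auto
      have Dn: "D n \<in> topspace X"
        using D(1) by blast
      have close: "\<bar>dist_to d z B - dist_to d (D n) B\<bar> < e / 3" if "B \<in> CL X" for B
        using lip[OF that z Dn] lip[OF that Dn z] n commute[of z "D n"]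
        unfolding abs_less_iff by linarith
      let ?W = "{B \<in> topspace \<T>. dist_to d (D n) B \<in> ball (dist_to d (D n) A) (e / 3)}"
      have "openin \<T> ?W"
        using coord[of n] open_ball unfolding continuous_map_def open_openin[symmetric] by blast
      moreover have "\<bar>dist_to d z B - dist_to d z A\<bar> < e" if "B \<in> ?W" for B
        using that close[of A] close[of B] A unfolding top by (simp add: dist_real_def) argo
      ultimately show ?thesis
        using A e top by (intro exI[of _ ?W]) auto
    qed
    have "continuous_map \<T> Met_TC.mtopology (dist_to d z)"
      unfolding Met_TC.continuous_map_to_metric using nbhd
      by (simp add: top dist_real_def abs_minus_commute)
    then show ?thesis
      by simp
  qed
  then have "openin \<T> \<U>"
    using wijsman_topology_weakest[OF top] assms(4) by blast
  then show ?thesis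
    unfolding \<T>_def openin_pullback_topology \<Psi>_def by auto
qed

text \<open>The sublevel sets say that \<open>tree_set T\<close> meets an open ball, which is an open condition, so the
  distance is upper semicontinuous in \<open>T\<close>.\<close>

lemma borel_dist_to_tree_set:
  assumes "Metric_space (topspace PI_space) d"
    and "Metric_space.mtopology (topspace PI_space) d = PI_space"
    and z: "z \<in> topspace PI_space"
  shows "(\<lambda>T. dist_to d z (tree_set T)) \<in> borel_measurable borel"
proof -
  interpret Metric_space "topspace PI_space" d by fact
  have "{T. dist_to d z (tree_set T) < r} = {T. tree_set T \<inter> mball z r \<noteq> {}}" for r
  proof -
    have "dist_to d z (tree_set T) < r \<longleftrightarrow> tree_set T \<inter> mball z r \<noteq> {}" for T
    proof -
      have ne: "tree_set T \<noteq> {}" and sub: "tree_set T \<subseteq> topspace PI_space"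
        using tree_set_in_CL[of T] closedin_subset by (auto simp: CL_def)
      have "bdd_below (d z ` tree_set T)"
        by (rule bdd_belowI[of _ 0]) auto
      then have "dist_to d z (tree_set T) < r \<longleftrightarrow> (\<exists>a\<in>tree_set T. d z a < r)"
        unfolding dist_to_def by (rule cINF_less_iff[OF ne])
      moreover have "d z a < r \<longleftrightarrow> a \<in> mball z r" if "a \<in> tree_set T" for a
        using that sub z by auto
      ultimately show ?thesis
        by blast
    qed
    then show ?thesis
      by simp
  qed
  moreover have "openin PI_space (mball z r)" for r
    using openin_mball[of z r] unfolding assms(2) .
  ultimately show ?thesis
    unfolding borel_measurable_iff_less using open_tree_set_meets by (auto intro!: borel_open)
qed

lemma borel_preimage_tree_set:
  assumes "Metric_space (topspace PI_space) d"
    and "Metric_space.mtopology (topspace PI_space) d = PI_space"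
    and "borel_set_in (wijsman_topology PI_space d) \<A>"
  shows "{T. tree_set T \<in> \<A>} \<in> sets borel"
proof -
  interpret Metric_space "topspace PI_space" d by fact
  obtain D0 where D0: "countable D0" "D0 \<subseteq> topspace PI_space"
    "topspace PI_space \<subseteq> closure D0"
    using separable[of "topspace PI_space"] by auto
  have "topspace PI_space \<noteq> {}"
    using cf_digits_surj by (auto simp: PI_space_eq)
  then have "D0 \<noteq> {}"
    using D0(3) by auto
  then have "range (from_nat_into D0) = D0"
    using D0(1) by (simp add: range_from_nat_into)
  then obtain D :: "nat \<Rightarrow> real \<times> real" where D: "range D = D0"
    by (rule that)
  have dense: "\<exists>n. d z (D n) < e" if z: "z \<in> topspace PI_space" and e: "e > 0" for z e
  proof -
    have "openin PI_space (mball z e)"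
      using openin_mball[of z e] unfolding assms(2) .
    then obtain O' where O': "open O'" "mball z e = topspace PI_space \<inter> O'"
      unfolding PI_space_eq openin_open by auto
    have "z \<in> O'" "z \<in> closure D0"
      using O'(2) z e D0(3) by auto
    then have "O' \<inter> D0 \<noteq> {}"
      using O'(1) open_Int_closure_eq_empty by blast
    then obtain n where "D n \<in> O'"
      using D by blast
    then have "D n \<in> mball z e"
      using D D0(2) O'(2) by blast
    then show ?thesis
      by auto
  qed
  have meas: "(\<lambda>T. \<lambda>n. dist_to d (D n) (tree_set T)) \<in> borel_measurable borel"
    using D D0(2) by (intro measurable_coordinatewise_then_product borel_dist_to_tree_set assms(1,2)) auto
  have "\<A> \<in> sigma_sets (CL PI_space) {U. openin (wijsman_topology PI_space d) U}"
    using assms(3) by (simp add: borel_set_in_def)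
  then show ?thesis
  proof induction
    case (Basic U)
    then obtain V where V: "open V" "U = {A \<in> CL PI_space. (\<lambda>n. dist_to d (D n) A) \<in> V}"
      using wijsman_open_from_countable_data[OF assms(1), of D U] D D0(2) dense by auto
    then have "{T. tree_set T \<in> U} = (\<lambda>T. \<lambda>n. dist_to d (D n) (tree_set T)) -` V \<inter> space borel"
      using tree_set_in_CL by auto
    then show ?case
      using measurable_sets[OF meas borel_open[OF V(1)]] by simp
  next
    case Empty
    then show ?case
      by simp
  next
    case (Compl U)
    have "{T. tree_set T \<in> CL PI_space - U} = space borel - {T. tree_set T \<in> U}"
      using tree_set_in_CL by auto
    then show ?case
      using sets.compl_sets[OF Compl.IH] by simp
  next
    case (Union U)
    have "{T. tree_set T \<in> (\<Union>i. U i)} = (\<Union>i. {T. tree_set T \<in> U i})"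
      by auto
    then show ?case
      using Union.IH by auto
  qed
qed

text \<open>Applied to the space of trees, this provides the metrizability required by
  \<open>borel_imp_analytic\<close>.\<close>

lemma metrizable_discrete_functions:
  "metrizable_space (euclidean :: ('a::countable \<Rightarrow> 'b::discrete_topology) topology)"
proof -
  have "(euclidean :: 'b topology) = discrete_topology UNIV"
    by (simp add: topology_eq open_discrete flip: open_openin)
  then show ?thesis
    unfolding euclidean_product_topology[symmetric] metrizable_space_product_topology
    by (simp add: metrizable_space_discrete_topology)
qed

lemma borel_imp_souslin:
  assumes "borel_set_in X S"
  shows "souslin_set_in X S"
  unfolding souslin_set_in_def using assms by (intro exI[of _ "\<lambda>_. S"]) auto

theorem mainTheorem3:
  fixes d :: "real \<times> real \<Rightarrow> real \<times> real \<Rightarrow> real"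
  assumes "Metric_space (topspace PI_space) d"
    and "Metric_space.mtopology (topspace PI_space) d = PI_space"
  shows "\<not> borel_set_in (wijsman_topology PI_space d) (F0 PI_space)
       \<and> \<not> souslin_set_in (wijsman_topology PI_space d) (F0 PI_space)"
proof -
  have "\<not> souslin_set_in (wijsman_topology PI_space d) (F0 PI_space)"
  proof
    assume "souslin_set_in (wijsman_topology PI_space d) (F0 PI_space)"
    then obtain \<A> :: "nat list \<Rightarrow> (real \<times> real) set set"
      where \<A>: "\<And>s. borel_set_in (wijsman_topology PI_space d) (\<A> s)"
        "F0 PI_space = (\<Union>\<sigma>. \<Inter>n. \<A> (map \<sigma> [0..<n]))"
      unfolding souslin_set_in_def by blast
    have "analytic_set {T. tree_set T \<in> \<A> s}" for s
      by (rule borel_imp_analytic[OF metrizable_discrete_functions borel_preimage_tree_set[OF assms \<A>(1)]])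
    then have "analytic_set (\<Union>\<sigma>. \<Inter>n. {T. tree_set T \<in> \<A> (map \<sigma> [0..<n])})"
      by (rule analytic_souslin_operation)
    moreover have "(\<Union>\<sigma>. \<Inter>n. {T. tree_set T \<in> \<A> (map \<sigma> [0..<n])}) = {T. tree_set T \<in> F0 PI_space}"
      unfolding \<A>(2) by blast
    ultimately show False
      using wellfounded_trees_not_analytic by (simp add: tree_set_in_F0_iff)
  qed
  then show ?thesis
    using borel_imp_souslin by blast
qed

end
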